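(* Let $d, n$ be positive integers with $d \geq 2$ and $n \geq d$. Let $D = (d_{1}, \dots, d_{n}) \in \mathbf{R}^n$ with $d_{1} \geq \cdots \geq d_{n} \geq 0$. Then there exists a $d$-uniform weighted hypergraph on the vertex set $V=\{v_1,\dots,v_n\}$ with weighted degree sequence $D$ if and only if \[ d\, d_{1} \leq \sum_{i=1}^{n} d_{i}. \] Moreover, if this inequality holds, then there exists such a $d$-uniform weighted hypergraph with weighted degree sequence $D$ that has at most $n$ edges with positive weight.
   Context: Let $V = \{v_1,\dots,v_n\}$ and $d \geq 2$. A $d$-uniform weighted hypergraph on $V$ is a triple $(V,E,w)$ where $E = \{e_1,\dots,e_m\}$ is a set of subsets of $V$ with $|e_i| = d$ for each $i$ and $\bigcup_{i=1}^m e_i = V$, and $w: E \to \mathbf{R}$ is a map with $w \geq 0$ (weights). The weighted degree at $v_i$ is $d_i := \sum_{e_j \in E,\ v_i \in e_j} w(e_j)$, and $(d_1,\dots,d_n)$ is the weighted degree sequence. *)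

theory Defs
  imports "HOL-Analysis.Analysis"
begin

text \<open>The weight function is total in HOL; only its values on the edge set matter.\<close>

definition uniform_weighted_hypergraph ::
    "nat \<Rightarrow> 'a set \<Rightarrow> 'a set set \<Rightarrow> ('a set \<Rightarrow> real) \<Rightarrow> bool" where
  "uniform_weighted_hypergraph d V E w \<longleftrightarrow>
     2 \<le> d \<and> finite V \<and>
     (\<forall>e\<in>E. e \<subseteq> V \<and> card e = d) \<and> \<Union>E = V \<and>
     (\<forall>e\<in>E. 0 \<le> w e)"

definition weighted_degree :: "'a set set \<Rightarrow> ('a set \<Rightarrow> real) \<Rightarrow> 'a \<Rightarrow> real" where
  "weighted_degree E w x = (\<Sum>e\<in>{e\<in>E. x \<in> e}. w e)"

definition has_weighted_degree_sequence ::
    "nat \<Rightarrow> (nat \<Rightarrow> 'a) \<Rightarrow> 'a set set \<Rightarrow> ('a set \<Rightarrow> real) \<Rightarrow> (nat \<Rightarrow> real) \<Rightarrow> bool" where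
  "has_weighted_degree_sequence n v E w D \<longleftrightarrow>
     (\<forall>i\<in>{1..n}. weighted_degree E w (v i) = D i)"

end

theory Submission
  imports Defs
begin

text \<open>
  Double counting incidences gives \<open>\<Sum> D = d * S\<close> with \<open>S\<close> the total weight, and no degree
  exceeds \<open>S\<close>; this is necessity.  Conversely put \<open>S = \<Sum> D / d\<close>, so every demand lies in
  \<open>[0, S]\<close>.  Choose an edge that contains all vertices with demand \<open>S\<close> and avoids all vertices with
  demand \<open>0\<close>, and give it the largest weight \<open>t\<close> that keeps the remaining demands in
  \<open>[0, S - t]\<close>.  Demands at an endpoint of the interval stay at that endpoint, and by maximality of
  \<open>t\<close> one more demand reaches an endpoint.  A single demand can never be strictly inside while all
  others are at endpoints, because the demands sum to a multiple of \<open>S\<close>; hence the last step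
  settles at least two vertices, and at most \<open>n\<close> edges are used.
\<close>

lemma sum_weighted_degree:
  assumes "finite V" and "\<forall>e\<in>E. e \<subseteq> V \<and> card e = d"
  shows "(\<Sum>x\<in>V. weighted_degree E w x) = real d * sum w E"
proof -
  have "finite E"
    using assms by (meson PowI finite_Pow_iff finite_subset subsetI)
  have "(\<Sum>x\<in>V. weighted_degree E w x) = (\<Sum>x\<in>V. \<Sum>e\<in>E. if x \<in> e then w e else 0)"
    using \<open>finite E\<close> by (simp add: weighted_degree_def sum.inter_filter)
  also have "\<dots> = (\<Sum>e\<in>E. \<Sum>x\<in>V. if x \<in> e then w e else 0)"
    by (rule sum.swap)
  also have "\<dots> = (\<Sum>e\<in>E. real d * w e)"
  proof (rule sum.cong)
    fix e assume "e \<in> E"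
    then have "e \<subseteq> V" "card e = d" using assms by auto
    then have "{x \<in> V. x \<in> e} = e" by auto
    then show "(\<Sum>x\<in>V. if x \<in> e then w e else 0) = real d * w e"
      using \<open>finite V\<close> \<open>card e = d\<close> by (simp flip: sum.inter_filter)
  qed simp
  finally show ?thesis by (simp add: sum_distrib_left)
qed

lemma weighted_degree_le_sum:
  assumes "finite E" and "\<forall>e\<in>E. 0 \<le> w e"
  shows "weighted_degree E w x \<le> sum w E"
  unfolding weighted_degree_def using assms by (intro sum_mono2) auto

text \<open>Stated as an increment because in the recursion the chosen edge may already carry weight
  from the recursive call.\<close>

lemma weighted_degree_fun_upd_add:
  assumes "finite E" and "a \<in> E"
  shows "weighted_degree E (w(a := w a + t)) x = weighted_degree E w x + (if x \<in> a then t else 0)"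
proof -
  have "weighted_degree E (w(a := w a + t)) x
      = (\<Sum>e\<in>{e\<in>E. x \<in> e}. w e + (if e = a then t else 0))"
    unfolding weighted_degree_def by (intro sum.cong) auto
  also have "\<dots> = weighted_degree E w x + (\<Sum>e\<in>{e\<in>E. x \<in> e}. if e = a then t else 0)"
    by (simp add: sum.distrib weighted_degree_def)
  also have "(\<Sum>e\<in>{e\<in>E. x \<in> e}. if e = a then t else 0) = (if x \<in> a then t else 0)"
    using assms by (subst sum.delta) auto
  finally show ?thesis .
qed

text \<open>The endpoint demands contribute an integer multiple of \<open>S\<close>, and so does the
  total. A lone interior demand would then be an integer multiple of \<open>S\<close> strictly
  between \<open>0\<close> and \<open>S\<close>.\<close>

lemma bounded_demands_card_interior_ne_1:
  fixes x :: "'a \<Rightarrow> real"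
  assumes "finite V" and "0 < S" and "\<forall>u\<in>V. 0 \<le> x u \<and> x u \<le> S" and "sum x V = real d * S"
  shows "card {u\<in>V. 0 < x u \<and> x u < S} \<noteq> 1"
proof
  assume "card {u\<in>V. 0 < x u \<and> x u < S} = 1"
  then obtain a where a: "{u\<in>V. 0 < x u \<and> x u < S} = {a}"
    by (auto simp: card_1_singleton_iff)
  then have aV: "a \<in> V" "0 < x a" "x a < S" by auto
  define A where "A = {u \<in> V - {a}. x u = S}"
  have "sum x (V - {a}) = (\<Sum>u\<in>V - {a}. if x u = S then S else 0)"
    using a assms(3) by (intro sum.cong) (auto simp: set_eq_iff, force)
  also have "\<dots> = real (card A) * S"
    using \<open>finite V\<close> by (simp add: A_def flip: sum.inter_filter)
  finally have "x a = (real d - real (card A)) * S"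
    using assms(4) sum.remove[OF \<open>finite V\<close> aV(1), of x] by (simp add: algebra_simps)
  with aV \<open>0 < S\<close> have "0 < real d - real (card A)" "real d - real (card A) < 1"
    by (simp_all add: zero_less_mult_iff)
  then have "card A < d" "d < card A + 1" by linarith+
  then show False by simp
qed

text \<open>Full demands contribute \<open>S\<close> each to a total of \<open>d * S\<close>, so
  there are at most \<open>d\<close> of them. Positive demands contribute at most \<open>S\<close>
  each, so there are at least \<open>d\<close> of them. A set of size \<open>d\<close> fits in
  between.\<close>

lemma exists_edge_through_full_demands:
  fixes x :: "'a \<Rightarrow> real"
  assumes "finite V" and "0 < S" and "\<forall>u\<in>V. 0 \<le> x u \<and> x u \<le> S" and "sum x V = real d * S"
  obtains a where "{u\<in>V. x u = S} \<subseteq> a" "a \<subseteq> {u\<in>V. 0 < x u}" "card a = d"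
proof -
  have "real (card {u\<in>V. x u = S}) * S = (\<Sum>u\<in>{u\<in>V. x u = S}. x u)" by simp
  also have "\<dots> \<le> sum x V" using assms by (intro sum_mono2) auto
  finally have 1: "card {u\<in>V. x u = S} \<le> d" using assms by simp
  have "sum x V = sum x {u\<in>V. 0 < x u}"
    using assms by (intro sum.mono_neutral_right) force+
  also have "\<dots> \<le> real (card {u\<in>V. 0 < x u}) * S"
    using assms by (intro sum_bounded_above) auto
  finally have 2: "d \<le> card {u\<in>V. 0 < x u}" using assms by simp
  show ?thesis
    using exists_subset_between[OF 1 2] assms that by auto
qed

text \<open>Induction on the number of interior demands, with \<open>S\<close> varying since each
  step lowers the total weight still to be placed. The \<open>max 1\<close> covers the case without
  interior demands, where one edge of weight \<open>S\<close> may be left.\<close>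

lemma exists_weights_with_degrees:
  fixes x :: "'a \<Rightarrow> real"
  assumes "finite V" and "0 \<le> S"
    and "\<forall>u\<in>V. 0 \<le> x u \<and> x u \<le> S" and "sum x V = real d * S"
  defines "E \<equiv> {e. e \<subseteq> V \<and> card e = d}"
  shows "\<exists>w. (\<forall>e. 0 \<le> w e) \<and> (\<forall>u\<in>V. weighted_degree E w u = x u) \<and>
           card {e\<in>E. 0 < w e} \<le> max 1 (card {u\<in>V. 0 < x u \<and> x u < S})"
  using assms(2-4)
proof (induction "card {u\<in>V. 0 < x u \<and> x u < S}" arbitrary: x S rule: less_induct)
  case less
  define U where "U = {u\<in>V. 0 < x u \<and> x u < S}"
  have finE: "finite E" unfolding E_def using \<open>finite V\<close> by simp
  show ?case
  proof (cases "S = 0")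
    case True
    then show ?thesis
      using less.prems by (intro exI[of _ "\<lambda>_. 0"]) (force simp: weighted_degree_def)
  next
    case False
    with less.prems have S: "0 < S" by simp
    obtain a where a: "{u\<in>V. x u = S} \<subseteq> a" "a \<subseteq> {u\<in>V. 0 < x u}" "card a = d"
      using exists_edge_through_full_demands[OF \<open>finite V\<close> S less.prems(2,3)] by blast
    have aE: "a \<in> E" using a by (auto simp: E_def)
    have aV: "a \<subseteq> V" "finite a" using a \<open>finite V\<close> by (auto intro: finite_subset)
    show ?thesis
    proof (cases "U = {}")
      case True
      define w where "w = (\<lambda>e. 0::real)(a := 0 + S)"
      \<comment> \<open>With no interior demand, \<open>a\<close> is exactly the set of full
        demands, and all other demands are \<open>0\<close>.\<close>
      have "weighted_degree E w u = x u" if "u \<in> V" for u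
      proof -
        have "weighted_degree E w u = (if u \<in> a then S else 0)"
          unfolding w_def using weighted_degree_fun_upd_add[OF finE aE, of "\<lambda>_. 0" S u]
          by (simp add: weighted_degree_def)
        also have "\<dots> = x u"
          using True a less.prems that unfolding U_def by force
        finally show ?thesis .
      qed
      moreover have "{e\<in>E. 0 < w e} \<subseteq> {a}" by (auto simp: w_def split: if_splits)
      then have "card {e\<in>E. 0 < w e} \<le> 1"
        using card_mono[of "{a}"] by simp
      ultimately show ?thesis using S
        by (intro exI[of _ w]) (auto simp: w_def)
    next
      case False
      have finU: "finite U" using \<open>finite V\<close> by (simp add: U_def)
      have U2: "2 \<le> card U"
      proof -
        have "card U \<noteq> 0" using False finU by simp
        moreover have "card U \<noteq> 1"
          using bounded_demands_card_interior_ne_1[OF \<open>finite V\<close> S less.prems(2,3)]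
          by (simp add: U_def)
        ultimately show ?thesis by linarith
      qed
      \<comment> \<open>The weight that \<open>a\<close> can receive before \<open>u\<close> blocks
        it: inside \<open>a\<close> the demand sinks to \<open>0\<close>; outside, the upper bound
        sinks to the unchanged demand.\<close>
      define slack where "slack u = (if u \<in> a then x u else S - x u)" for u
      define t where "t = Min (slack ` V)"
      have V0: "V \<noteq> {}" using False by (auto simp: U_def)
      have t_le: "t \<le> slack u" if "u \<in> V" for u
        using that \<open>finite V\<close> by (simp add: t_def)
      obtain b where b: "b \<in> V" "t = slack b"
        using Min_in[of "slack ` V"] V0 \<open>finite V\<close> unfolding t_def by blast
      \<comment> \<open>This is where the choice of \<open>a\<close> enters: no zero demand lies
        inside it and no full demand outside.\<close>
      have slack_pos: "0 < slack u" if "u \<in> V" for u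
        using that a less.prems unfolding slack_def by force
      then have t0: "0 < t" using b by simp
      have tS: "t < S"
      proof -
        obtain u where u: "u \<in> U" using False by auto
        then have "slack u < S" by (auto simp: slack_def U_def)
        with t_le[of u] u show ?thesis by (auto simp: U_def)
      qed
      define x' where "x' u = x u - (if u \<in> a then t else 0)" for u
      define U' where "U' = {u\<in>V. 0 < x' u \<and> x' u < S - t}"
      have bnd: "\<forall>u\<in>V. 0 \<le> x' u \<and> x' u \<le> S - t"
        using t_le less.prems unfolding x'_def slack_def by (force split: if_splits)
      have "(\<Sum>u\<in>V. if u \<in> a then t else 0) = real d * t"
      proof -
        have "{u\<in>V. u \<in> a} = a" using aV by auto
        then show ?thesis using \<open>finite V\<close> a(3) by (simp flip: sum.inter_filter)
      qed
      then have sum': "sum x' V = real d * (S - t)"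
        using less.prems(3) by (simp add: x'_def sum_subtractf algebra_simps)
      have "U' \<subseteq> U - {b}"
      proof
        fix u assume u: "u \<in> U'"
        then have uV: "u \<in> V" by (simp add: U'_def)
        have "u \<noteq> b" using u b(2) by (auto simp: U'_def x'_def slack_def split: if_splits)
        moreover have "x u \<noteq> 0" using u a t0 by (auto simp: U'_def x'_def split: if_splits)
        moreover have "x u \<noteq> S" using u a by (auto simp: U'_def x'_def split: if_splits)
        ultimately show "u \<in> U - {b}" using less.prems(2) uV by (force simp: U_def)
      qed
      \<comment> \<open>Here \<open>x b\<close> is \<open>t\<close> or \<open>S - t\<close>, and
        \<open>0 < t < S\<close>. So the minimizer \<open>b\<close> was interior and has now
        left.\<close>
      moreover have "b \<in> U"
        using b tS t0 a unfolding U_def slack_def by (auto split: if_splits)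
      ultimately have cU: "card U' < card U"
        using finU by (intro psubset_card_mono) auto
      obtain w where w: "\<forall>e. 0 \<le> w e" "\<forall>u\<in>V. weighted_degree E w u = x' u"
        "card {e\<in>E. 0 < w e} \<le> max 1 (card U')"
        using less.hyps[of x' "S - t"] cU bnd sum' tS unfolding U_def U'_def by auto
      define w' where "w' = w(a := w a + t)"
      have "{e\<in>E. 0 < w' e} \<subseteq> insert a {e\<in>E. 0 < w e}"
        by (auto simp: w'_def split: if_splits)
      then have "card {e\<in>E. 0 < w' e} \<le> Suc (card {e\<in>E. 0 < w e})"
        using finE card_mono[of "insert a {e\<in>E. 0 < w e}" "{e\<in>E. 0 < w' e}"]
        by (simp add: card_insert_if split: if_splits)
      \<comment> \<open>If \<open>U'\<close> is empty, the recursive call may still use one edge,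
        two in all; \<open>U2\<close> absorbs this.\<close>
      then have "card {e\<in>E. 0 < w' e} \<le> max 1 (card U)"
        using w(3) cU U2 by linarith
      moreover have "\<forall>u\<in>V. weighted_degree E w' u = x u"
        unfolding w'_def weighted_degree_fun_upd_add[OF finE aE] using w(2)
        by (simp add: x'_def)
      moreover have "\<forall>e. 0 \<le> w' e" using w(1) t0 by (simp add: w'_def)
      ultimately show ?thesis unfolding U_def by blast
    qed
  qed
qed

theorem theorem4p4:
  fixes d n :: nat and v :: "nat \<Rightarrow> 'a" and V :: "'a set" and D :: "nat \<Rightarrow> real"
  assumes "2 \<le> d" and "d \<le> n"
    and "inj_on v {1..n}" and "V = v ` {1..n}"
    and "antimono_on {1..n} D" and "0 \<le> D n"
  shows "((\<exists>E w. uniform_weighted_hypergraph d V E w \<and> has_weighted_degree_sequence n v E w D)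
            \<longleftrightarrow> real d * D 1 \<le> (\<Sum>i=1..n. D i)) \<and>
         (real d * D 1 \<le> (\<Sum>i=1..n. D i) \<longrightarrow>
            (\<exists>E w. uniform_weighted_hypergraph d V E w \<and> has_weighted_degree_sequence n v E w D \<and>
                   card {e\<in>E. 0 < w e} \<le> n))"
proof -
  have finV: "finite V" and cardV: "card V = n"
    using assms by (auto simp: card_image)
  have necessary: "real d * D 1 \<le> (\<Sum>i=1..n. D i)"
    if H: "uniform_weighted_hypergraph d V E w" "has_weighted_degree_sequence n v E w D" for E w
  proof -
    have E: "\<forall>e\<in>E. e \<subseteq> V \<and> card e = d" "\<forall>e\<in>E. 0 \<le> w e"
      using H by (auto simp: uniform_weighted_hypergraph_def)
    then have "finite E"
      using finV by (meson PowI finite_Pow_iff finite_subset subsetI)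
    have "D 1 = weighted_degree E w (v 1)"
      using H assms by (simp add: has_weighted_degree_sequence_def)
    also have "\<dots> \<le> sum w E" using \<open>finite E\<close> E by (intro weighted_degree_le_sum)
    finally have "real d * D 1 \<le> real d * sum w E" by (simp add: mult_left_mono)
    also have "\<dots> = (\<Sum>x\<in>V. weighted_degree E w x)"
      using sum_weighted_degree[OF finV E(1)] by simp
    also have "\<dots> = (\<Sum>i=1..n. weighted_degree E w (v i))"
      using assms by (simp add: sum.reindex)
    also have "\<dots> = (\<Sum>i=1..n. D i)"
      using H by (simp add: has_weighted_degree_sequence_def)
    finally show ?thesis .
  qed
  have sufficient: "\<exists>E w. uniform_weighted_hypergraph d V E w \<and>
      has_weighted_degree_sequence n v E w D \<and> card {e\<in>E. 0 < w e} \<le> n"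
    if H: "real d * D 1 \<le> (\<Sum>i=1..n. D i)"
  proof -
    define x where "x u = D (the_inv_into {1..n} v u)" for u
    have x: "x (v i) = D i" if "i \<in> {1..n}" for i
      using that assms by (simp add: x_def the_inv_into_f_f)
    \<comment> \<open>By double counting, the only possible total weight; the assumed inequality
      says precisely that \<open>D 1\<close> does not exceed it.\<close>
    define S where "S = (\<Sum>i=1..n. D i) / real d"
    have D_le: "D i \<le> D 1" "0 \<le> D i" if "i \<in> {1..n}" for i
      using monotone_onD[OF assms(5), of 1 i] monotone_onD[OF assms(5), of i n] that assms(6)
      by auto
    have "D 1 \<le> S" using H assms(1) by (simp add: S_def field_simps)
    then have x_bnd: "\<forall>u\<in>V. 0 \<le> x u \<and> x u \<le> S"
      using D_le x assms(4) by fastforce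
    have "0 \<le> S" unfolding S_def using D_le by (intro divide_nonneg_nonneg sum_nonneg) auto
    have "sum x V = (\<Sum>i=1..n. x (v i))" using assms by (simp add: sum.reindex)
    also have "\<dots> = real d * S" using x assms(1) by (simp add: S_def)
    finally have x_sum: "sum x V = real d * S" .
    define E where "E = {e. e \<subseteq> V \<and> card e = d}"
    from exists_weights_with_degrees[OF finV \<open>0 \<le> S\<close> x_bnd x_sum]
    obtain w where w: "\<forall>e. 0 \<le> w e" "\<forall>u\<in>V. weighted_degree E w u = x u"
      "card {e\<in>E. 0 < w e} \<le> max 1 (card {u\<in>V. 0 < x u \<and> x u < S})"
      unfolding E_def by blast
    have "card {u\<in>V. 0 < x u \<and> x u < S} \<le> n"
      using card_mono[OF finV, of "{u\<in>V. 0 < x u \<and> x u < S}"] cardV by auto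
    then have "card {e\<in>E. 0 < w e} \<le> n" using w(3) assms(1,2) by linarith
    \<comment> \<open>Edges of weight \<open>0\<close> belong to \<open>E\<close> too, so even
      vertices of degree \<open>0\<close> are covered.\<close>
    moreover have "V \<subseteq> \<Union>E"
    proof
      fix u assume "u \<in> V"
      then obtain e where "{u} \<subseteq> e" "e \<subseteq> V" "card e = d"
        using exists_subset_between[of "{u}" d V] finV cardV assms(1,2) by auto
      then show "u \<in> \<Union>E" by (auto simp: E_def)
    qed
    then have "uniform_weighted_hypergraph d V E w"
      using assms(1) finV w(1) by (auto simp: uniform_weighted_hypergraph_def E_def)
    moreover have "has_weighted_degree_sequence n v E w D"
      using w(2) x assms(4) by (simp add: has_weighted_degree_sequence_def)
    ultimately show ?thesis by blast
  qed
  show ?thesis using necessary sufficient by blast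
qed

end
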